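(* (i) For every $f \in \mathcal{G}$ there are $g \in \mathcal{G}$ and a recursive injective function $j:\mathbb{N}\to\mathbb{N}$ such that for all $x,y$: $x \equiv_f y \iff |[j\langle x,y\rangle]_g| < \infty$. (ii) For every $g \in \mathcal{G}$ there are $f \in \mathcal{G}$ and two recursive injective functions $j, j':\mathbb{N}\to\mathbb{N}$ such that for all $x$: $|[x]_g| < \infty \iff j(x) \equiv_f j'(x)$.
   Context: $\mathcal{G}$ is the group of recursive permutations of $\mathbb{N}$; $[x]_f = \{f^k(x):k\in\mathbb{Z}\}$ and $x\equiv_f y$ means $y\in[x]_f$; $\langle\cdot,\cdot\rangle$ is a recursive pairing bijection $\mathbb{N}^2\to\mathbb{N}$. *)

theory Defs
  imports Main
begin

text \<open>
  General recursive functions: \<open>general_recursive n F\<close> says that \<open>F\<close>, restricted to argument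
  lists of length \<open>n\<close>, belongs to the least class of total functions that contains the
  initial functions and is closed under composition, primitive recursion and minimisation
  of regular functions (Kleene). Values of \<open>F\<close> on lists of any other length carry no meaning.
\<close>

inductive general_recursive :: "nat \<Rightarrow> (nat list \<Rightarrow> nat) \<Rightarrow> bool" where
  zero: "general_recursive n (\<lambda>xs. 0)"
| succ: "general_recursive 1 (\<lambda>xs. Suc (xs ! 0))"
| proj: "i < n \<Longrightarrow> general_recursive n (\<lambda>xs. xs ! i)"
| comp: "general_recursive m F \<Longrightarrow> length Gs = m \<Longrightarrow> \<forall>G\<in>set Gs. general_recursive n G \<Longrightarrow>
    general_recursive n (\<lambda>xs. F (map (\<lambda>G. G xs) Gs))"
| prec: "general_recursive n G \<Longrightarrow> general_recursive (n + 2) H \<Longrightarrow>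
    general_recursive (n + 1)
      (\<lambda>xs. rec_nat (G (tl xs)) (\<lambda>k r. H (k # r # tl xs)) (hd xs))"
| mu: "general_recursive (n + 1) F \<Longrightarrow> \<forall>xs. length xs = n \<longrightarrow> (\<exists>y. F (y # xs) = 0) \<Longrightarrow>
    general_recursive n (\<lambda>xs. LEAST y. F (y # xs) = 0)"

definition recursive :: "(nat \<Rightarrow> nat) \<Rightarrow> bool" where
  "recursive f \<longleftrightarrow> (\<exists>F. general_recursive 1 F \<and> (\<forall>x. f x = F [x]))"

definition recursive2 :: "(nat \<Rightarrow> nat \<Rightarrow> nat) \<Rightarrow> bool" where
  "recursive2 f \<longleftrightarrow> (\<exists>F. general_recursive 2 F \<and> (\<forall>x y. f x y = F [x, y]))"

definition recursive_pairing :: "(nat \<Rightarrow> nat \<Rightarrow> nat) \<Rightarrow> bool" where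
  "recursive_pairing p \<longleftrightarrow> recursive2 p \<and> bij (\<lambda>(x, y). p x y)"

text \<open>The underlying set of the group of recursive permutations of the natural numbers; the
  inverse of a recursive permutation is automatically recursive, so this is not demanded.\<close>

definition rec_perms :: "(nat \<Rightarrow> nat) set" where
  "rec_perms = {f. bij f \<and> recursive f}"

text \<open>Integer powers are meaningful for bijections \<open>f\<close> only.\<close>

definition zpower :: "('a \<Rightarrow> 'a) \<Rightarrow> int \<Rightarrow> 'a \<Rightarrow> 'a" where
  "zpower f k = (if 0 \<le> k then f ^^ nat k else inv f ^^ nat (- k))"

definition zorbit :: "('a \<Rightarrow> 'a) \<Rightarrow> 'a \<Rightarrow> 'a set" where
  "zorbit f x = {zpower f k x | k. True}"

definition zorbit_equiv :: "('a \<Rightarrow> 'a) \<Rightarrow> 'a \<Rightarrow> 'a \<Rightarrow> bool" where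
  "zorbit_equiv f x y \<longleftrightarrow> y \<in> zorbit f x"

end

theory Submission
  imports Defs
begin

text \<open>
  Both parts come from one construction. Given a decidable relation \<open>E p k\<close>, attach to every
  \<open>p\<close> two bi-infinite lines, realised on the codes \<open>4 * k + c\<close> with \<open>c < 4\<close>: codes \<open>c = 0, 2\<close>
  move outwards (increasing \<open>k\<close>), codes \<open>c = 1, 3\<close> move inwards, and at \<open>k = 0\<close> the inward
  ray \<open>1\<close> continues as the outward ray \<open>2\<close>, and \<open>3\<close> as \<open>0\<close>. Wherever \<open>E p k\<close> holds, outward
  movers at \<open>k\<close> are reflected into inward movers at \<open>k\<close>, and inward movers at \<open>k + 1\<close> into
  outward movers at \<open>k + 1\<close>. If \<open>E p\<close> never holds, the codes \<open>0\<close> and \<open>1\<close> lie on different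
  infinite orbits; otherwise the four rays below the first reflection close up to one finite cycle
  containing both. For (i) use \<open>E \<langle>x, y\<rangle> k \<longleftrightarrow> f\<^sup>k x = y \<or> f\<^sup>k y = x\<close>, for (ii) use
  \<open>E x k \<longleftrightarrow> g\<^sup>k\<^sup>+\<^sup>1 x = x\<close>.
\<close>

section \<open>Closure properties of recursive functions\<close>

text \<open>\<open>general_recursive n\<close> is sensitive to values on lists of the wrong length; this variant is not.\<close>

definition recursive_fun :: "nat \<Rightarrow> (nat list \<Rightarrow> nat) \<Rightarrow> bool" where
  "recursive_fun n F \<longleftrightarrow> (\<exists>G. general_recursive n G \<and> (\<forall>xs. length xs = n \<longrightarrow> F xs = G xs))"

definition recursive_pred :: "nat \<Rightarrow> (nat list \<Rightarrow> bool) \<Rightarrow> bool" where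
  "recursive_pred n P \<longleftrightarrow> recursive_fun n (\<lambda>xs. of_bool (P xs))"

lemma recursive_fun_cong:
  assumes "\<And>xs. length xs = n \<Longrightarrow> F xs = G xs" "recursive_fun n G"
  shows "recursive_fun n F"
  using assms unfolding recursive_fun_def by auto

lemma recursive_fun_general_recursive: "general_recursive n F \<Longrightarrow> recursive_fun n F"
  unfolding recursive_fun_def by auto

lemma recursive_iff_recursive_fun: "recursive f \<longleftrightarrow> recursive_fun 1 (\<lambda>xs. f (xs ! 0))"
proof
  assume "recursive f"
  then show "recursive_fun 1 (\<lambda>xs. f (xs ! 0))"
    unfolding recursive_def recursive_fun_def by (auto simp: length_Suc_conv)
next
  assume "recursive_fun 1 (\<lambda>xs. f (xs ! 0))"
  then obtain F where "general_recursive 1 F" "\<forall>xs. length xs = 1 \<longrightarrow> f (xs ! 0) = F xs"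
    unfolding recursive_fun_def by auto
  then have "general_recursive 1 F \<and> (\<forall>x. f x = F [x])"
    by (metis length_Cons list.size(3) nth_Cons_0 One_nat_def)
  then show "recursive f"
    unfolding recursive_def by blast
qed

lemma recursive_fun_proj: "i < n \<Longrightarrow> recursive_fun n (\<lambda>xs. xs ! i)"
  by (intro recursive_fun_general_recursive general_recursive.proj)

text \<open>Recursion, bounded quantification and minimisation prepend variables to the parameter
  list, so inside their bodies each parameter is read through one \<open>tl\<close> per variable.
  These variants let the introduction rules match such terms.\<close>

lemma recursive_fun_proj_tl: "Suc i < n \<Longrightarrow> recursive_fun n (\<lambda>xs. tl xs ! i)"
  by (rule recursive_fun_cong[OF _ recursive_fun_proj[of "Suc i"]]) (auto simp: nth_tl)

lemma recursive_fun_proj_tl_tl: "Suc (Suc i) < n \<Longrightarrow> recursive_fun n (\<lambda>xs. tl (tl xs) ! i)"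
  by (rule recursive_fun_cong[OF _ recursive_fun_proj[of "Suc (Suc i)"]]) (auto simp: nth_tl)

lemma recursive_fun_proj_tl_tl_tl:
  "Suc (Suc (Suc i)) < n \<Longrightarrow> recursive_fun n (\<lambda>xs. tl (tl (tl xs)) ! i)"
  by (rule recursive_fun_cong[OF _ recursive_fun_proj[of "Suc (Suc (Suc i))"]]) (auto simp: nth_tl)

text \<open>Only values of \<open>F\<close> on lists of length \<open>length Gs\<close> enter, so
  \<open>F\<close> and every member of \<open>Gs\<close> may be replaced by general recursive
  representatives.\<close>

lemma recursive_fun_comp:
  assumes "recursive_fun (length Gs) F" "\<And>G. G \<in> set Gs \<Longrightarrow> recursive_fun n G"
  shows "recursive_fun n (\<lambda>xs. F (map (\<lambda>G. G xs) Gs))"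
proof -
  obtain F' where F': "general_recursive (length Gs) F'"
    "\<And>xs. length xs = length Gs \<Longrightarrow> F xs = F' xs"
    using assms(1) unfolding recursive_fun_def by auto
  obtain r where r: "\<And>G. G \<in> set Gs \<Longrightarrow> general_recursive n (r G)"
    "\<And>G xs. G \<in> set Gs \<Longrightarrow> length xs = n \<Longrightarrow> G xs = r G xs"
    using assms(2) unfolding recursive_fun_def by metis
  have "general_recursive n (\<lambda>xs. F' (map (\<lambda>G. G xs) (map r Gs)))"
    by (rule general_recursive.comp[OF F'(1)]) (auto simp: r(1))
  moreover have "F (map (\<lambda>G. G xs) Gs) = F' (map (\<lambda>G. G xs) (map r Gs))"
    if "length xs = n" for xs
  proof -
    have "map (\<lambda>G. G xs) (map r Gs) = map (\<lambda>G. G xs) Gs"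
      using r(2) that by auto
    then show ?thesis using F'(2)[of "map (\<lambda>G. G xs) Gs"] by (simp only: length_map)
  qed
  ultimately show ?thesis unfolding recursive_fun_def by blast
qed

lemma recursive_comp:
  assumes "recursive f" "recursive_fun n A"
  shows "recursive_fun n (\<lambda>xs. f (A xs))"
  using recursive_fun_comp[of "[A]" "\<lambda>xs. f (xs ! 0)" n] assms
  by (simp add: recursive_iff_recursive_fun)

lemma recursive2_comp:
  assumes "recursive2 f" "recursive_fun n A" "recursive_fun n B"
  shows "recursive_fun n (\<lambda>xs. f (A xs) (B xs))"
proof -
  obtain F where "general_recursive 2 F" "\<And>x y. f x y = F [x, y]"
    using assms(1) unfolding recursive2_def by auto
  then show ?thesis
    using recursive_fun_comp[of "[A, B]" F n] assms(2,3)
    by (auto simp: recursive_fun_general_recursive numeral_2_eq_2)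
qed

text \<open>Composition with \<open>A\<close> and all \<open>n\<close> projections; this supplies
  the computed recursion argument in \<open>recursive_fun_rec_nat\<close>.\<close>

lemma recursive_fun_prepend:
  assumes "recursive_fun (Suc n) F" "recursive_fun n A"
  shows "recursive_fun n (\<lambda>xs. F (A xs # xs))"
proof (rule recursive_fun_cong)
  let ?Gs = "A # map (\<lambda>i xs. xs ! i) [0..<n]"
  show "recursive_fun n (\<lambda>xs. F (map (\<lambda>G. G xs) ?Gs))"
    by (rule recursive_fun_comp) (use assms in \<open>auto intro: recursive_fun_proj\<close>)
  show "F (A xs # xs) = F (map (\<lambda>G. G xs) ?Gs)" if "length xs = n" for xs
    using that by (simp add: comp_def map_nth flip: that)
qed

lemma recursive_fun_tl:
  assumes "recursive_fun n F"
  shows "recursive_fun (Suc n) (\<lambda>xs. F (tl xs))"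
proof (rule recursive_fun_cong)
  let ?Gs = "map (\<lambda>i xs. xs ! Suc i) [0..<n]"
  show "recursive_fun (Suc n) (\<lambda>xs. F (map (\<lambda>G. G xs) ?Gs))"
    by (rule recursive_fun_comp) (use assms in \<open>auto intro: recursive_fun_proj\<close>)
  show "F (tl xs) = F (map (\<lambda>G. G xs) ?Gs)" if "length xs = Suc n" for xs
  proof -
    have "tl xs = map (\<lambda>G. G xs) ?Gs"
      by (rule nth_equalityI) (use that in \<open>auto simp: nth_tl\<close>)
    then show ?thesis by simp
  qed
qed

lemma recursive_fun_rec_nat:
  assumes "recursive_fun n A" "recursive_fun n B"
    "recursive_fun (Suc (Suc n)) (\<lambda>ys. H (ys ! 0) (ys ! 1) (tl (tl ys)))"
  shows "recursive_fun n (\<lambda>xs. rec_nat (B xs) (\<lambda>k r. H k r xs) (A xs))"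
proof -
  obtain B' where B': "general_recursive n B'" "\<And>xs. length xs = n \<Longrightarrow> B xs = B' xs"
    using assms(2) unfolding recursive_fun_def by auto
  obtain H' where H': "general_recursive (Suc (Suc n)) H'"
    "\<And>ys. length ys = Suc (Suc n) \<Longrightarrow> H (ys ! 0) (ys ! 1) (tl (tl ys)) = H' ys"
    using assms(3) unfolding recursive_fun_def by auto
  have H'_eq: "H k r xs = H' (k # r # xs)" if "length xs = n" for k r xs
    using H'(2)[of "k # r # xs"] that by simp
  have "general_recursive (n + 1)
      (\<lambda>xs. rec_nat (B' (tl xs)) (\<lambda>k r. H' (k # r # tl xs)) (hd xs))"
    by (rule general_recursive.prec) (use B' H' in auto)
  then have "recursive_fun (Suc n)
      (\<lambda>xs. rec_nat (B' (tl xs)) (\<lambda>k r. H' (k # r # tl xs)) (hd xs))"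
    using recursive_fun_general_recursive by simp
  from recursive_fun_prepend[OF this assms(1)] show ?thesis
    by (rule recursive_fun_cong[rotated]) (simp add: B'(2) H'_eq)
qed

section \<open>Arithmetic, case distinction, bounded quantification and search\<close>

lemma recursive_fun_Suc: "recursive_fun n A \<Longrightarrow> recursive_fun n (\<lambda>xs. Suc (A xs))"
  by (rule recursive_comp[of Suc])
    (simp add: recursive_iff_recursive_fun recursive_fun_general_recursive
      general_recursive.succ[unfolded One_nat_def])

lemma recursive_fun_const: "recursive_fun n (\<lambda>xs. c)"
proof (induction c)
  case 0
  show ?case by (intro recursive_fun_general_recursive general_recursive.zero)
next
  case (Suc c)
  then show ?case by (rule recursive_fun_Suc)
qed

lemma recursive_fun_funpow:
  assumes "recursive f" "recursive_fun n A" "recursive_fun n B"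
  shows "recursive_fun n (\<lambda>xs. (f ^^ A xs) (B xs))"
proof -
  have "(f ^^ k) x = rec_nat x (\<lambda>_. f) k" for k x
    by (induction k) auto
  moreover have "recursive_fun n (\<lambda>xs. rec_nat (B xs) (\<lambda>k r. f r) (A xs))"
    by (intro recursive_fun_rec_nat recursive_comp[OF assms(1)] recursive_fun_proj assms) auto
  ultimately show ?thesis by simp
qed

lemma recursive_fun_add:
  assumes "recursive_fun n A" "recursive_fun n B"
  shows "recursive_fun n (\<lambda>xs. A xs + B xs)"
proof -
  have "recursive_fun n (\<lambda>xs. (Suc ^^ A xs) (B xs))"
    by (intro recursive_fun_funpow assms)
      (auto simp: recursive_iff_recursive_fun intro: recursive_fun_Suc recursive_fun_proj)
  then show ?thesis by (simp add: Suc_funpow)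
qed

lemma recursive_fun_diff:
  assumes "recursive_fun n A" "recursive_fun n B"
  shows "recursive_fun n (\<lambda>xs. A xs - B xs)"
proof -
  have "k - 1 = rec_nat 0 (\<lambda>k r. k) k" for k :: nat
    by (cases k) auto
  then have "recursive (\<lambda>k. k - 1)"
    unfolding recursive_iff_recursive_fun
    by (simp only:) (intro recursive_fun_rec_nat recursive_fun_proj recursive_fun_const; simp)
  then have "recursive_fun n (\<lambda>xs. ((\<lambda>k. k - 1) ^^ B xs) (A xs))"
    by (intro recursive_fun_funpow assms)
  moreover have "((\<lambda>k. k - 1) ^^ b) a = a - b" for a b :: nat
    by (induction b) auto
  ultimately show ?thesis by simp
qed

lemma recursive_fun_if:
  assumes "recursive_pred n P" "recursive_fun n A" "recursive_fun n B"
  shows "recursive_fun n (\<lambda>xs. if P xs then A xs else B xs)"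
proof -
  \<comment> \<open>The recursion runs for zero steps or one, returning \<open>B xs\<close> if the
    condition fails and \<open>A xs\<close> if it holds.\<close>
  have "recursive_fun n (\<lambda>xs. rec_nat (B xs) (\<lambda>k r. A xs) (of_bool (P xs)))"
    using assms
    by (intro recursive_fun_rec_nat recursive_fun_tl) (auto simp: recursive_pred_def)
  then show ?thesis
    by (rule recursive_fun_cong[rotated]) simp
qed

lemma recursive_pred_less:
  assumes "recursive_fun n A" "recursive_fun n B"
  shows "recursive_pred n (\<lambda>xs. A xs < B xs)"
proof -
  \<comment> \<open>Subtracting twice from 1 turns every positive difference into 1.\<close>
  have "recursive_fun n (\<lambda>xs. 1 - (1 - (B xs - A xs)))"
    by (intro recursive_fun_diff recursive_fun_const assms)
  then show ?thesis unfolding recursive_pred_def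
    by (rule recursive_fun_cong[rotated]) auto
qed

lemma recursive_pred_disj:
  assumes "recursive_pred n P" "recursive_pred n Q"
  shows "recursive_pred n (\<lambda>xs. P xs \<or> Q xs)"
proof -
  have "recursive_fun n (\<lambda>xs. if P xs then 1 else of_bool (Q xs))"
    using assms by (intro recursive_fun_if recursive_fun_const) (auto simp: recursive_pred_def)
  then show ?thesis unfolding recursive_pred_def
    by (rule recursive_fun_cong[rotated]) auto
qed

lemma recursive_pred_eq:
  assumes "recursive_fun n A" "recursive_fun n B"
  shows "recursive_pred n (\<lambda>xs. A xs = B xs)"
proof -
  \<comment> \<open>Both truncated differences vanish exactly at equality.\<close>
  have "recursive_fun n (\<lambda>xs. 1 - ((A xs - B xs) + (B xs - A xs)))"
    by (intro recursive_fun_diff recursive_fun_add recursive_fun_const assms)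
  then show ?thesis unfolding recursive_pred_def
    by (rule recursive_fun_cong[rotated]) auto
qed

lemma recursive_pred_even:
  assumes "recursive_fun n A"
  shows "recursive_pred n (\<lambda>xs. even (A xs))"
proof -
  have "(of_bool (even k) :: nat) = rec_nat 1 (\<lambda>k r. 1 - r) k" for k :: nat
    by (induction k) auto
  moreover have "recursive_fun n (\<lambda>xs. rec_nat 1 (\<lambda>k r. 1 - r) (A xs))"
    by (intro recursive_fun_rec_nat recursive_fun_diff recursive_fun_proj recursive_fun_const assms)
      auto
  ultimately show ?thesis by (simp add: recursive_pred_def)
qed

lemma recursive_fun_half:
  assumes "recursive_fun n A"
  shows "recursive_fun n (\<lambda>xs. A xs div 2)"
proof -
  have "k div 2 = rec_nat 0 (\<lambda>k r. if even k then r else Suc r) k" for k :: nat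
    by (induction k) auto
  moreover have "recursive_fun n (\<lambda>xs. rec_nat 0 (\<lambda>k r. if even k then r else Suc r) (A xs))"
    by (intro recursive_fun_rec_nat recursive_fun_if recursive_pred_even recursive_fun_Suc
        recursive_fun_proj recursive_fun_const assms) auto
  ultimately show ?thesis by simp
qed

lemma recursive_pred_bounded_ex:
  assumes "recursive_fun n A" "recursive_pred (Suc n) (\<lambda>ys. P (ys ! 0) (tl ys))"
  shows "recursive_pred n (\<lambda>xs. \<exists>k < A xs. P k xs)"
proof -
  have "(of_bool (\<exists>k < a. P k xs) :: nat) = rec_nat 0 (\<lambda>k r. if P k xs then 1 else r) a" for a xs
  proof (induction a)
    case (Suc a)
    have "(\<exists>k < Suc a. P k xs) \<longleftrightarrow> P a xs \<or> (\<exists>k < a. P k xs)"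
      by (auto simp: less_Suc_eq)
    then show ?case by (simp flip: Suc)
  qed simp
  \<comment> \<open>The recursion step receives the counter, the previous value and the parameters;
    the predicate must skip the previous value.\<close>
  moreover have "recursive_pred (Suc (Suc n)) (\<lambda>ys. P (ys ! 0) (tl (tl ys)))"
    unfolding recursive_pred_def
  proof (rule recursive_fun_cong)
    let ?Gs = "(\<lambda>ys. ys ! 0) # map (\<lambda>i ys. ys ! Suc (Suc i)) [0..<n]"
    let ?F = "\<lambda>ys. of_bool (P (ys ! 0) (tl ys)) :: nat"
    show "recursive_fun (Suc (Suc n)) (\<lambda>ys. ?F (map (\<lambda>G. G ys) ?Gs))"
      by (rule recursive_fun_comp)
        (use assms(2) in \<open>auto simp: recursive_pred_def intro: recursive_fun_proj\<close>)
    show "of_bool (P (ys ! 0) (tl (tl ys))) = ?F (map (\<lambda>G. G ys) ?Gs)"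
      if "length ys = Suc (Suc n)" for ys
    proof -
      have "tl (tl ys) = map (\<lambda>i. ys ! Suc (Suc i)) [0..<n]"
        by (rule nth_equalityI) (use that in \<open>auto simp: nth_tl\<close>)
      then show ?thesis by (simp add: comp_def)
    qed
  qed
  then have "recursive_fun n (\<lambda>xs. rec_nat 0 (\<lambda>k r. if P k xs then 1 else r) (A xs))"
    by (intro recursive_fun_rec_nat recursive_fun_if recursive_fun_proj recursive_fun_const assms)
      auto
  ultimately show ?thesis by (simp add: recursive_pred_def)
qed

lemma recursive_fun_Least:
  assumes "recursive_pred (Suc n) (\<lambda>ys. P (ys ! 0) (tl ys))"
    and ex: "\<And>xs. length xs = n \<Longrightarrow> \<exists>k. P k xs"
  shows "recursive_fun n (\<lambda>xs. LEAST k. P k xs)"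
proof -
  \<comment> \<open>\<open>mu\<close> searches for a zero, so the characteristic function is
    complemented; \<open>ex\<close> gives the regularity that \<open>mu\<close> demands.\<close>
  have "recursive_fun (Suc n) (\<lambda>ys. 1 - of_bool (P (ys ! 0) (tl ys)))"
    using assms(1) unfolding recursive_pred_def
    by (intro recursive_fun_diff recursive_fun_const)
  then obtain F where F: "general_recursive (Suc n) F"
    "\<And>ys. length ys = Suc n \<Longrightarrow> 1 - (of_bool (P (ys ! 0) (tl ys)) :: nat) = F ys"
    unfolding recursive_fun_def by auto
  have F_iff: "F (k # xs) = 0 \<longleftrightarrow> P k xs" if "length xs = n" for k xs
    using F(2)[of "k # xs"] that by (cases "P k xs") auto
  have "general_recursive n (\<lambda>xs. LEAST y. F (y # xs) = 0)"
    by (rule general_recursive.mu) (use F(1) ex F_iff in auto)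
  then show ?thesis
    unfolding recursive_fun_def using F_iff by (intro exI conjI) auto
qed

lemmas recursive_fun_intros =
  recursive_fun_if recursive_pred_even recursive_pred_less recursive_pred_eq recursive_pred_disj
  recursive_fun_half recursive_fun_add recursive_fun_diff recursive_fun_Suc recursive_fun_const
  recursive_fun_proj recursive_fun_proj_tl recursive_fun_proj_tl_tl recursive_fun_proj_tl_tl_tl

section \<open>Recursive inverses of the pairing\<close>

lemma recursive_pairing_projections:
  assumes "recursive_pairing pair"
  obtains p q where "recursive p" "recursive q"
    "\<And>x y. p (pair x y) = x" "\<And>x y. q (pair x y) = y" "\<And>z. pair (p z) (q z) = z"
proof -
  have rec: "recursive2 pair" and bij: "bij (\<lambda>(x, y). pair x y)"
    using assms unfolding recursive_pairing_def by auto
  have inj: "pair x y = pair x' y' \<longleftrightarrow> x = x' \<and> y = y'" for x y x' y'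
    using inj_eq[OF bij_is_inj[OF bij], of "(x, y)" "(x', y')"] by simp
  have surj: "\<exists>x y. pair x y = z" for z
    using surjD[OF bij_is_surj[OF bij], of z] by auto
  \<comment> \<open>No bound on the components of \<open>z\<close> is known in advance. An unbounded
    search first finds one, \<open>w z\<close>; the existential over the second component in
    \<open>p\<close> can then be bounded.\<close>
  define w where "w z = (LEAST w. \<exists>x<w. \<exists>y<w. pair x y = z)" for z
  define p where "p z = (LEAST x. \<exists>y<w z. pair x y = z)" for z
  define q where "q z = (LEAST y. pair (p z) y = z)" for z
  have ex_w: "\<exists>w. \<exists>x<w. \<exists>y<w. pair x y = z" for z
  proof -
    obtain x y where "pair x y = z" using surj by blast
    moreover have "x < Suc (x + y)" "y < Suc (x + y)" by simp_all
    ultimately show ?thesis by blast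
  qed
  have w: "\<exists>x<w z. \<exists>y<w z. pair x y = z" for z
    unfolding w_def by (rule LeastI_ex[OF ex_w])
  then have ex_p: "\<exists>x. \<exists>y<w z. pair x y = z" for z
    by blast
  have "\<exists>y<w z. pair (p z) y = z" for z
    unfolding p_def by (rule LeastI_ex[OF ex_p])
  then have ex_q: "\<exists>y. pair (p z) y = z" for z
    by blast
  have pair_pq: "pair (p z) (q z) = z" for z
    unfolding q_def by (rule LeastI_ex[OF ex_q])
  have w_rec: "recursive w"
    unfolding recursive_iff_recursive_fun w_def
    by (intro recursive_fun_Least recursive_pred_bounded_ex recursive_fun_intros
        recursive2_comp[OF rec] ex_w) auto
  have p_rec: "recursive p"
    unfolding recursive_iff_recursive_fun p_def
    by (intro recursive_fun_Least recursive_pred_bounded_ex recursive_fun_intros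
        recursive2_comp[OF rec] recursive_comp[OF w_rec] ex_p) auto
  have q_rec: "recursive q"
    unfolding recursive_iff_recursive_fun q_def
    by (intro recursive_fun_Least recursive_fun_intros
        recursive2_comp[OF rec] recursive_comp[OF p_rec] ex_q) auto
  show thesis
    using that[OF p_rec q_rec] pair_pq inj by blast
qed

section \<open>Orbits\<close>

text \<open>Natural powers in both directions replace \<open>inv f\<close>; for recursive
  \<open>f\<close> this leaves a condition decidable for each \<open>n\<close>.\<close>

lemma zorbit_equiv_iff:
  assumes "bij f"
  shows "zorbit_equiv f x y \<longleftrightarrow> (\<exists>n. (f ^^ n) x = y \<or> (f ^^ n) y = x)"
proof -
  have inv_pow: "(inv f ^^ n) x = y \<longleftrightarrow> (f ^^ n) y = x" for n x y
    using bij_inv_eq_iff[OF bij_fn[OF assms, of n], of y x] by (metis inv_fn[OF assms])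
  have "zorbit_equiv f x y \<longleftrightarrow> (\<exists>k. zpower f k x = y)"
    unfolding zorbit_equiv_def zorbit_def by blast
  also have "\<dots> \<longleftrightarrow> (\<exists>n. (f ^^ n) x = y \<or> (inv f ^^ n) x = y)"
  proof
    show "\<exists>n. (f ^^ n) x = y \<or> (inv f ^^ n) x = y" if "\<exists>k. zpower f k x = y"
      using that unfolding zpower_def by metis
    assume "\<exists>n. (f ^^ n) x = y \<or> (inv f ^^ n) x = y"
    then obtain n where "(f ^^ n) x = y \<or> (inv f ^^ n) x = y" by blast
    \<comment> \<open>For \<open>n = 0\<close> the exponent \<open>- int n\<close> falls under the
      nonnegative branch of \<open>zpower\<close>, hence the case split.\<close>
    then have "zpower f (int n) x = y \<or> zpower f (- int n) x = y"
      by (cases "n = 0") (simp_all add: zpower_def)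
    then show "\<exists>k. zpower f k x = y" by blast
  qed
  finally show ?thesis by (simp add: inv_pow)
qed

text \<open>The equivalence, rather than an implication, carries the invariant along backward
  iterates as well.\<close>

lemma zorbit_invariant:
  assumes "bij f" "\<And>z. P (f z) \<longleftrightarrow> P z" "P x" "y \<in> zorbit f x"
  shows "P y"
proof -
  have "P ((f ^^ n) z) \<longleftrightarrow> P z" for n z
    by (induction n) (auto simp: assms(2))
  moreover obtain n where "(f ^^ n) x = y \<or> (f ^^ n) y = x"
    using zorbit_equiv_iff[OF assms(1)] assms(4) unfolding zorbit_equiv_def by blast
  ultimately show ?thesis using assms(3) by blast
qed

lemma funpow_in_zorbit: "bij f \<Longrightarrow> (f ^^ n) x \<in> zorbit f x"
  unfolding zorbit_equiv_def[symmetric] by (auto simp: zorbit_equiv_iff)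

lemma finite_zorbit_iff:
  assumes "bij f"
  shows "finite (zorbit f x) \<longleftrightarrow> (\<exists>n. (f ^^ Suc n) x = x)"
proof
  assume "finite (zorbit f x)"
  then have "finite (range (\<lambda>n. (f ^^ n) x))"
    by (rule finite_subset[rotated]) (auto simp: funpow_in_zorbit[OF assms])
  then have "\<not> inj (\<lambda>n. (f ^^ n) x)"
    using finite_imageD by blast
  then obtain a b where ab: "a < b" "(f ^^ a) x = (f ^^ b) x"
    unfolding inj_def by (metis nat_neq_iff)
  \<comment> \<open>Since \<open>b = a + Suc (b - Suc a)\<close>, injectivity of
    \<open>f ^^ a\<close> leaves a positive power fixing \<open>x\<close>.\<close>
  then have "(f ^^ a) x = (f ^^ a) ((f ^^ Suc (b - Suc a)) x)"
    unfolding comp_apply[symmetric, of "f ^^ a"] funpow_add[symmetric] by simp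
  then show "\<exists>n. (f ^^ Suc n) x = x"
    using bij_fn[OF assms] by (metis bij_is_inj injD)
next
  assume "\<exists>n. (f ^^ Suc n) x = x"
  then obtain n where n: "(f ^^ Suc n) x = x" by blast
  define S where "S = (\<lambda>k. (f ^^ k) x) ` {..n}"
  have "f ` S \<subseteq> S"
  proof
    fix y assume "y \<in> f ` S"
    then obtain k where k: "k \<le> n" "y = (f ^^ Suc k) x"
      unfolding S_def by auto
    show "y \<in> S"
    proof (cases "k = n")
      case True
      then have "y = (f ^^ 0) x" using k n by simp
      then show ?thesis unfolding S_def by blast
    next
      case False
      then show ?thesis using k unfolding S_def by (metis Suc_leI imageI atMost_iff le_neq_implies_less)
    qed
  qed
  \<comment> \<open>An injective self-map of a finite set is onto, so \<open>S\<close> is closed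
    under preimages too, as \<open>zorbit_invariant\<close> requires.\<close>
  then have image_S: "f ` S = S"
    by (intro endo_inj_surj) (auto simp: S_def intro: inj_on_subset[OF bij_is_inj[OF assms]])
  have "f z \<in> S \<longleftrightarrow> z \<in> S" for z
    using image_S bij_is_inj[OF assms] by (metis inj_image_mem_iff)
  moreover have "x \<in> S"
    unfolding S_def by (rule image_eqI[of _ _ 0]) auto
  ultimately have "zorbit f x \<subseteq> S"
    using zorbit_invariant[OF assms, of "\<lambda>z. z \<in> S"] by blast
  then show "finite (zorbit f x)"
    by (rule finite_subset) (simp add: S_def)
qed

section \<open>The reflected lines\<close>

text \<open>The position is read off as \<open>m div 2 div 2\<close> because halving is already
  known to be recursive. \<open>3 - m\<close> is the turn at the centre, from 1 to 2 and from 3 to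
  0. The \<open>- 1\<close> inside \<open>E\<close> is there because an inward mover at
  \<open>k + 1\<close> meets the reflection belonging to \<open>k\<close>.\<close>

definition reflect_step :: "(nat \<Rightarrow> bool) \<Rightarrow> nat \<Rightarrow> nat" where
  "reflect_step E m =
    (if even m then if E (m div 2 div 2) then Suc m else m + 4
     else if m < 4 then 3 - m
     else if E (m div 2 div 2 - 1) then m - 1 else m - 4)"

lemma quarter_simps:
  "(4 * k + 2) div 2 div 2 = (k :: nat)"
  "(4 * k + 5) div 2 div 2 = Suc k"
  "(4 * k + 7) div 2 div 2 = Suc k"
  by presburger+

lemma reflect_step_simps [simp]:
  "reflect_step E (4 * k) = (if E k then 4 * k + 1 else 4 * k + 4)"
  "reflect_step E (4 * k + 2) = (if E k then 4 * k + 3 else 4 * k + 6)"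
  "reflect_step E 1 = 2"
  "reflect_step E 3 = 0"
  "reflect_step E (4 * k + 5) = (if E k then 4 * k + 4 else 4 * k + 1)"
  "reflect_step E (4 * k + 7) = (if E k then 4 * k + 6 else 4 * k + 3)"
  using quarter_simps[of k] by (auto simp: reflect_step_def)

lemma reflect_cases:
  fixes m :: nat
  obtains k where "m = 4 * k" | k where "m = 4 * k + 2" | "m = 1" | "m = 3"
    | k where "m = 4 * k + 5" | k where "m = 4 * k + 7"
proof -
  have "(\<exists>k. m = 4 * k) \<or> (\<exists>k. m = 4 * k + 2) \<or> m = 1 \<or> m = 3 \<or>
      (\<exists>k. m = 4 * k + 5) \<or> (\<exists>k. m = 4 * k + 7)"
    by presburger
  then show thesis using that by blast
qed

definition flip :: "nat \<Rightarrow> nat" where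
  "flip m = (if even m then Suc m else m - 1)"

lemma flip_flip: "flip (flip m) = m"
  by (auto simp: flip_def)

text \<open>Swapping inward and outward movers reverses time.\<close>

lemma reflect_step_flip: "reflect_step E (flip (reflect_step E m)) = flip m"
proof -
  have flip_simps: "flip (4 * k) = 4 * k + 1" "flip (4 * k + 1) = 4 * k"
    "flip (4 * k + 2) = 4 * k + 3" "flip (4 * k + 3) = 4 * k + 2"
    "flip (4 * k + 4) = 4 * k + 5" "flip (4 * k + 5) = 4 * k + 4"
    "flip (4 * k + 6) = 4 * k + 7" "flip (4 * k + 7) = 4 * k + 6"
    "flip 0 = 1" "flip 1 = 0" "flip 2 = 3" "flip 3 = 2" for k
    by (auto simp: flip_def)
  have base: "reflect_step E 0 = (if E 0 then 1 else 4)"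
    "reflect_step E 2 = (if E 0 then 3 else 6)"
    by (simp_all add: reflect_step_def)
  show ?thesis
    by (cases m rule: reflect_cases)
      (simp_all only: reflect_step_simps base flip_simps split: if_split, simp_all)
qed

text \<open>Codes below \<open>4 * K + 4\<close> are those at positions up to \<open>K\<close>. Only
  steps between positions \<open>K\<close> and \<open>K + 1\<close> could cross this bound, and
  \<open>E K\<close> reflects exactly these.\<close>

lemma reflect_step_low_iff:
  assumes "E K"
  shows "reflect_step E m < 4 * K + 4 \<longleftrightarrow> m < 4 * K + 4"
proof -
  have ne: "k \<noteq> K" if "\<not> E k" for k
    using assms that by blast
  show ?thesis
    by (cases m rule: reflect_cases)
      (simp_all only: reflect_step_simps split: if_split, (safe dest!: ne; arith)+)
qed

text \<open>Without reflections ray 3 feeds into ray 0, and ray 1 into ray 2, so the residues 0 and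
  3 form one full line. This separates code 0 from code 1.\<close>

lemma reflect_step_mod_iff:
  assumes "\<And>k. \<not> E k"
  shows "reflect_step E m mod 4 \<in> {0, 3} \<longleftrightarrow> m mod 4 \<in> {0, 3}"
  by (cases m rule: reflect_cases)
    (simp_all only: reflect_step_simps assms if_False insert_iff empty_iff, presburger+)

lemma reflect_step_pow_0:
  assumes "\<And>i. i < k \<Longrightarrow> \<not> E i"
  shows "(reflect_step E ^^ k) 0 = 4 * k"
  using assms by (induction k) auto

lemma reflect_step_pow_inward:
  assumes "\<And>i. i < k \<Longrightarrow> \<not> E i"
  shows "(reflect_step E ^^ k) (4 * k + 1) = 1"
  using assms
proof (induction k)
  case (Suc k)
  \<comment> \<open>\<open>4 * Suc k + 1\<close> is \<open>4 * k + 5\<close>, the form in which the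
    inward rule is stated.\<close>
  have "reflect_step E (4 * Suc k + 1) = 4 * k + 1"
    using reflect_step_simps(5)[of E k] Suc.prems[of k] by (simp add: numeral_eq_Suc)
  then show ?case
    using Suc by (simp add: funpow_Suc_right del: funpow.simps)
qed simp

section \<open>One recursive permutation carrying the lines of every \<open>p\<close>\<close>

lemma reflection_permutation:
  assumes "recursive_pairing pair" and E: "recursive_pred 2 (\<lambda>xs. E (xs ! 0) (xs ! 1))"
  obtains h where "h \<in> rec_perms"
    "\<And>p. finite (zorbit h (pair p 0)) \<longleftrightarrow> (\<exists>k. E p k)"
    "\<And>p. zorbit_equiv h (pair p 0) (pair p 1) \<longleftrightarrow> (\<exists>k. E p k)"
proof -
  obtain u v where "recursive u" "recursive v" and u [simp]: "\<And>x y. u (pair x y) = x"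
    and v [simp]: "\<And>x y. v (pair x y) = y" and pair_uv: "\<And>z. pair (u z) (v z) = z"
    by (rule recursive_pairing_projections[OF assms(1)]) (rule that)
  have "recursive2 pair"
    using assms(1) by (simp add: recursive_pairing_def)
  \<comment> \<open>The first component \<open>u z\<close> indexes the fibre and stays fixed; the
    second is the code on the lines of that fibre.\<close>
  define h where "h z = pair (u z) (reflect_step (E (u z)) (v z))" for z
  define s where "s z = pair (u z) (flip (v z))" for z
  have u_h: "u (h z) = u z" and v_h: "v (h z) = reflect_step (E (u z)) (v z)" for z
    by (simp_all add: h_def)
  have s_s: "s (s z) = z" for z
    by (simp add: s_def flip_flip pair_uv)
  \<comment> \<open>Time reversal: as \<open>s\<close> is an involution, this identity makes
    \<open>s \<circ> h \<circ> s\<close> a two-sided inverse of \<open>h\<close>.\<close>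
  have "h (s (h z)) = s z" for z
    by (simp add: h_def s_def reflect_step_flip)
  then have "bij h"
    by (intro o_bij[of "s \<circ> h \<circ> s"]) (auto simp: fun_eq_iff s_s)
  have pow: "(h ^^ n) (pair p m) = pair p ((reflect_step (E p) ^^ n) m)" for n p m
    by (induction n) (auto simp: h_def)
  have E_comp: "recursive_pred n (\<lambda>xs. E (A xs) (B xs))"
    if "recursive_fun n A" "recursive_fun n B" for n A B
    using that recursive_fun_comp[of "[A, B]" "\<lambda>xs. of_bool (E (xs ! 0) (xs ! 1))" n] E
    by (auto simp: recursive_pred_def numeral_2_eq_2)
  have "recursive h"
    unfolding recursive_iff_recursive_fun h_def reflect_step_def
    by (intro recursive2_comp[OF \<open>recursive2 pair\<close>] recursive_comp[OF \<open>recursive u\<close>]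
        recursive_comp[OF \<open>recursive v\<close>] recursive_fun_intros E_comp) auto
  have reached: "finite (zorbit h (pair p 0)) \<and> zorbit_equiv h (pair p 0) (pair p 1)"
    if "\<exists>k. E p k" for p
  proof -
    define K where "K = (LEAST k. E p k)"
    have K: "E p K" "\<And>i. i < K \<Longrightarrow> \<not> E p i"
      unfolding K_def using LeastI_ex[OF that] not_less_Least by auto
    \<comment> \<open>The block at positions up to \<open>K\<close> in the fibre over
      \<open>p\<close> is finite and closed off by the reflection at \<open>K\<close>.\<close>
    define P where "P z \<longleftrightarrow> u z = p \<and> v z < 4 * K + 4" for z
    have "P (h z) \<longleftrightarrow> P z" for z
      using reflect_step_low_iff[of "E p", OF K(1)] by (auto simp: P_def u_h v_h)
    then have "zorbit h (pair p 0) \<subseteq> Collect P"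
      using zorbit_invariant[OF \<open>bij h\<close>, of P "pair p 0"] by (auto simp: P_def)
    also have "Collect P \<subseteq> pair p ` {..<4 * K + 4}"
      unfolding P_def using pair_uv by (auto simp: image_iff) (metis lessThan_iff)
    finally have "finite (zorbit h (pair p 0))"
      by (rule finite_subset) simp
    \<comment> \<open>\<open>K\<close> steps out from 0 to \<open>4 * K\<close>, one reflection to
      \<open>4 * K + 1\<close>, and \<open>K\<close> steps in to 1.\<close>
    moreover have "(reflect_step (E p) ^^ (K + Suc K)) 0 = 1"
      using K reflect_step_pow_0[of K "E p"] reflect_step_pow_inward[of K "E p"]
      by (simp add: funpow_add funpow_swap1)
    then have "zorbit_equiv h (pair p 0) (pair p 1)"
      unfolding zorbit_equiv_iff[OF \<open>bij h\<close>] pow by metis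
    ultimately show ?thesis ..
  qed
  have unreached: "infinite (zorbit h (pair p 0)) \<and> \<not> zorbit_equiv h (pair p 0) (pair p 1)"
    if "\<nexists>k. E p k" for p
  proof
    \<comment> \<open>Starting from 0, the code grows by 4 at every step, so the orbit never returns
      to its start.\<close>
    have "v ((h ^^ Suc n) (pair p 0)) = 4 * Suc n" for n
      unfolding pow using reflect_step_pow_0[of "Suc n" "E p"] that by (simp del: funpow.simps)
    then have "(h ^^ Suc n) (pair p 0) \<noteq> pair p 0" for n
      by (metis v mult_eq_0_iff nat.distinct(1) zero_neq_numeral)
    then show "infinite (zorbit h (pair p 0))"
      by (simp add: finite_zorbit_iff[OF \<open>bij h\<close>])
    \<comment> \<open>The invariant set is the line through code 0 in the fibre over
      \<open>p\<close>.\<close>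
    define P where "P z \<longleftrightarrow> u z = p \<and> v z mod 4 \<in> {0, 3}" for z
    have "\<not> E p k" for k
      using that by blast
    from reflect_step_mod_iff[of "E p", OF this] have "P (h z) \<longleftrightarrow> P z" for z
      unfolding P_def u_h v_h by (cases "u z = p") simp_all
    moreover have "P (pair p 0)" "\<not> P (pair p 1)"
      by (auto simp: P_def)
    ultimately show "\<not> zorbit_equiv h (pair p 0) (pair p 1)"
      using zorbit_invariant[OF \<open>bij h\<close>, of P "pair p 0" "pair p 1"] unfolding zorbit_equiv_def by blast
  qed
  show thesis
  proof (rule that)
    show "h \<in> rec_perms"
      using \<open>bij h\<close> \<open>recursive h\<close> by (simp add: rec_perms_def)
    show "finite (zorbit h (pair p 0)) \<longleftrightarrow> (\<exists>k. E p k)"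
      "zorbit_equiv h (pair p 0) (pair p 1) \<longleftrightarrow> (\<exists>k. E p k)" for p
      using reached[of p] unreached[of p] by argo+
  qed
qed

section \<open>The two reductions\<close>

theorem theorem4p13:
  fixes pair :: "nat \<Rightarrow> nat \<Rightarrow> nat"
  assumes "recursive_pairing pair"
  shows
    "(\<forall>f\<in>rec_perms. \<exists>g\<in>rec_perms. \<exists>j. recursive j \<and> inj j \<and>
        (\<forall>x y. zorbit_equiv f x y \<longleftrightarrow> finite (zorbit g (j (pair x y))))) \<and>
     (\<forall>g\<in>rec_perms. \<exists>f\<in>rec_perms. \<exists>j j'. recursive j \<and> inj j \<and> recursive j' \<and> inj j' \<and>
        (\<forall>x. finite (zorbit g x) \<longleftrightarrow> zorbit_equiv f (j x) (j' x)))"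
proof -
  obtain u v where "recursive u" "recursive v" and u [simp]: "\<And>x y. u (pair x y) = x"
    and v [simp]: "\<And>x y. v (pair x y) = y" and "\<And>z. pair (u z) (v z) = z"
    by (rule recursive_pairing_projections[OF assms]) (rule that)
  have "recursive2 pair"
    using assms by (simp add: recursive_pairing_def)
  have rec_j: "recursive (\<lambda>x. pair x c)" for c
    unfolding recursive_iff_recursive_fun
    by (intro recursive2_comp[OF \<open>recursive2 pair\<close>] recursive_fun_intros) auto
  have inj_j: "inj (\<lambda>x. pair x c)" for c
    by (rule inj_on_inverseI[of _ u]) simp
  show ?thesis
  proof (intro conjI ballI)
    fix f assume "f \<in> rec_perms"
    then have "bij f" "recursive f" by (auto simp: rec_perms_def)
    \<comment> \<open>Both directions appear so that a search over natural \<open>k\<close> covers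
      all integer powers.\<close>
    define E where "E p k \<longleftrightarrow> (f ^^ k) (u p) = v p \<or> (f ^^ k) (v p) = u p" for p k
    have "recursive_pred 2 (\<lambda>xs. E (xs ! 0) (xs ! 1))"
      unfolding E_def
      by (intro recursive_fun_intros recursive_fun_funpow[OF \<open>recursive f\<close>]
          recursive_comp[OF \<open>recursive u\<close>] recursive_comp[OF \<open>recursive v\<close>]) auto
    then obtain g where g: "g \<in> rec_perms"
      "\<And>p. finite (zorbit g (pair p 0)) \<longleftrightarrow> (\<exists>k. E p k)"
      "\<And>p. zorbit_equiv g (pair p 0) (pair p 1) \<longleftrightarrow> (\<exists>k. E p k)"
      by (rule reflection_permutation[of pair E, OF assms]) (rule that)
    show "\<exists>g\<in>rec_perms. \<exists>j. recursive j \<and> inj j \<and>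
        (\<forall>x y. zorbit_equiv f x y \<longleftrightarrow> finite (zorbit g (j (pair x y))))"
    proof (intro bexI[of _ g] exI[of _ "\<lambda>x. pair x 0"] conjI allI)
      show "zorbit_equiv f x y \<longleftrightarrow> finite (zorbit g (pair (pair x y) 0))" for x y
        by (simp only: zorbit_equiv_iff[OF \<open>bij f\<close>] g E_def u v)
    qed (fact g rec_j inj_j)+
  next
    fix g assume "g \<in> rec_perms"
    then have "bij g" "recursive g" by (auto simp: rec_perms_def)
    \<comment> \<open>The exponent is \<open>Suc k\<close> because the zeroth power fixes every
      point.\<close>
    define E where "E x k \<longleftrightarrow> (g ^^ Suc k) x = x" for x k
    have "recursive_pred 2 (\<lambda>xs. E (xs ! 0) (xs ! 1))"
      unfolding E_def
      by (intro recursive_fun_intros recursive_fun_funpow[OF \<open>recursive g\<close>]) auto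
    then obtain f where f: "f \<in> rec_perms"
      "\<And>p. finite (zorbit f (pair p 0)) \<longleftrightarrow> (\<exists>k. E p k)"
      "\<And>p. zorbit_equiv f (pair p 0) (pair p 1) \<longleftrightarrow> (\<exists>k. E p k)"
      by (rule reflection_permutation[of pair E, OF assms]) (rule that)
    show "\<exists>f\<in>rec_perms. \<exists>j j'. recursive j \<and> inj j \<and> recursive j' \<and> inj j' \<and>
        (\<forall>x. finite (zorbit g x) \<longleftrightarrow> zorbit_equiv f (j x) (j' x))"
    \<comment> \<open>\<open>j\<close> and \<open>j'\<close> pick the codes 0 and 1 in the fibre
      over \<open>x\<close>, which share an orbit exactly when some reflection occurs.\<close>
    proof (rule bexI[of _ f], rule exI[of _ "\<lambda>x. pair x 0"],
        rule exI[of _ "\<lambda>x. pair x 1"], intro conjI allI)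
      show "finite (zorbit g x) \<longleftrightarrow> zorbit_equiv f (pair x 0) (pair x 1)" for x
        by (simp only: finite_zorbit_iff[OF \<open>bij g\<close>] f E_def)
    qed (fact f rec_j inj_j)+
  qed
qed

end
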